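(* Let $\mathcal{G}$ be a (non-degenerate) $[n,k,d]_q$ A$^s$MDS code with $k\ge 2$. \begin{enumerate} \item If $s=0$ then $\mathcal{G}$ is projective. \item If $k=2$ then $\mathcal{G}$ is projective if and only if $s=0$. \item If $s>0$, $k>2$ and $n>m^{s-1}(k-1,q)+2$, then $\mathcal{G}$ is projective. \item If $k>2$ and $n>s(q+1)+k-1$, then $\mathcal{G}$ is projective. \item If $s=1$, $k>q$ and $n>k+2$, then $\mathcal{G}$ is projective. \end{enumerate}
   Context: A linear $[n,k,d]_q$ code is identified with a projective system: a finite multiset $\mathcal{G}$ of $n$ points (counted with multiplicity) of $\mathrm{PG}(k-1,q)$, not all lying in one hyperplane, with $n-d=\max_H|\mathcal{G}\cap H|$ over hyperplanes $H$ (counted with multiplicity); equivalently, the columns of a generator matrix of a non-degenerate linear code of length $n$, dimension $k$, minimum distance $d$ over $\mathbb{F}_q$. The Singleton defect is $S(\mathcal{G})=n-k+1-d$; $\mathcal{G}$ is A$^s$MDS if $S(\mathcal{G})=s$. The code is projective if $\mathcal{G}$ is a set, i.e. every point has multiplicity $1$. $m^s(k,q)$ denotes the maximum length $n$ of a non-degenerate $[n,k,d]_q$ A$^s$MDS code. *)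

theory Defs
  imports "Jordan_Normal_Form.VS_Connect" "HOL-Library.Multiset" "HOL-Library.Cardinality"
begin

definition lin_subspaces :: "nat \<Rightarrow> nat \<Rightarrow> 'a::field vec set set" where
  "lin_subspaces k r =
     {W. subspace class_ring W (module_vec TYPE('a) k) \<and>
         vectorspace.dim class_ring ((module_vec TYPE('a) k)\<lparr>carrier := W\<rparr>) = r}"

text \<open>Points and hyperplanes of \<open>PG(k - 1, q)\<close> are subspaces of \<open>F\<^sub>q\<^sup>k\<close>, given by their sets of
  vectors, so that incidence is inclusion.\<close>

definition PG_points :: "nat \<Rightarrow> 'a::field vec set set" where
  "PG_points k = lin_subspaces k 1"

definition PG_hyperplanes :: "nat \<Rightarrow> 'a::field vec set set" where
  "PG_hyperplanes k = lin_subspaces k (k - 1)"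

definition points_on :: "'a::field vec set multiset \<Rightarrow> 'a vec set \<Rightarrow> 'a vec set multiset" where
  "points_on G H = {#P \<in># G. P \<subseteq> H#}"

text \<open>An \<open>[n, k, d]\<^sub>q\<close> code as a projective system. Non-degeneracy (no zero column in a generator
  matrix) is built in, since every member of the multiset is a point.\<close>

definition linear_code ::
    "nat \<Rightarrow> nat \<Rightarrow> nat \<Rightarrow> 'a::{field,finite} vec set multiset \<Rightarrow> bool" where
  "linear_code n k d G \<longleftrightarrow>
     set_mset G \<subseteq> PG_points k \<and>
     size G = n \<and>
     \<not> (\<exists>H \<in> PG_hyperplanes k. \<forall>P \<in># G. P \<subseteq> H) \<and>
     int n - int d = int (MAX H \<in> PG_hyperplanes k. size (points_on G H))"

definition singleton_defect :: "nat \<Rightarrow> nat \<Rightarrow> nat \<Rightarrow> int" where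
  "singleton_defect n k d = int n - int k + 1 - int d"

definition AsMDS_code ::
    "nat \<Rightarrow> nat \<Rightarrow> nat \<Rightarrow> nat \<Rightarrow> 'a::{field,finite} vec set multiset \<Rightarrow> bool" where
  "AsMDS_code s n k d G \<longleftrightarrow> linear_code n k d G \<and> singleton_defect n k d = int s"

definition projective_code :: "'a::field vec set multiset \<Rightarrow> bool" where
  "projective_code G \<longleftrightarrow> (\<forall>P \<in># G. count G P = 1)"

text \<open>\<open>m\<^sup>s(k, q)\<close>, where the field type \<open>'a\<close> plays the role of \<open>F\<^sub>q\<close>. It is meaningful for \<open>k \<ge> 2\<close>;
  for \<open>k = 1\<close> and \<open>s = 0\<close> the lengths are unbounded.\<close>

definition max_AsMDS_length :: "'a::{field,finite} itself \<Rightarrow> nat \<Rightarrow> nat \<Rightarrow> nat" where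
  "max_AsMDS_length _ s k =
     Max {n. \<exists>d (G :: 'a vec set multiset). AsMDS_code s n k d G}"

end

theory Submission
  imports Defs
begin

text \<open>
  Suppose that a point \<open>P\<close> of the code has multiplicity at least 2. Since the code spans the space,
  \<open>P\<close> extends to a basis of code points; its dual basis supplies hyperplanes that contain many code
  points, because \<open>P\<close> counts twice, whereas every hyperplane contains at most \<open>k - 1 + s\<close> of them.

  \<^item> One member of the dual basis gives \<open>s > 0\<close>.
  \<^item> Two members cut out a subspace of codimension 2 with at least \<open>k - 1\<close> code points, and the
    \<open>q + 1\<close> hyperplanes through it cover the space, so \<open>n \<le> s (q + 1) + k - 1\<close>.
  \<^item> If \<open>s = 1\<close> and \<open>u\<close>, \<open>w\<close> are two further code points, then the ratios of their coordinates at the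
    \<open>k - 1\<close> basis points other than \<open>P\<close> are nonzero and pairwise distinct, so \<open>k - 1 \<le> q - 1\<close>.
  \<^item> Projecting from \<open>P\<close>, of multiplicity \<open>m\<close>, gives a code of length \<open>n - m\<close>, dimension \<open>k - 1\<close> and
    defect at most \<open>s + 1 - m\<close>. Doubling a point on a hyperplane of maximal intersection raises
    length and defect by 1, so there is a code of defect \<open>s - 1\<close> and length at least \<open>n - 2\<close>.
\<close>

section \<open>Points and hyperplanes as lines and kernels\<close>

text \<open>Hyperplanes are handled as kernels of functionals, so that incidence becomes the
  vanishing of a scalar product. For \<open>c = 0\<close> this is the whole space, which is why
  \<open>c\<close> being nonzero appears as a separate hypothesis.\<close>

definition vec_hyperplane :: "nat \<Rightarrow> 'a::field vec \<Rightarrow> 'a vec set" where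
  "vec_hyperplane k c = {x \<in> carrier_vec k. c \<bullet> x = 0}"

definition vec_line :: "'a::field vec \<Rightarrow> 'a vec set" where
  "vec_line v = range (\<lambda>a. a \<cdot>\<^sub>v v)"

lemma finite_carrier_vec: "finite (carrier_vec k :: 'a::finite vec set)"
proof (rule finite_subset)
  show "carrier_vec k \<subseteq> vec_of_list ` {xs :: 'a list. set xs \<subseteq> UNIV \<and> length xs = k}"
  proof
    fix v :: "'a vec" assume "v \<in> carrier_vec k"
    then have "v = vec_of_list (list_of_vec v)" "length (list_of_vec v) = k"
      by (auto simp: vec_list)
    then show "v \<in> vec_of_list ` {xs :: 'a list. set xs \<subseteq> UNIV \<and> length xs = k}" by blast
  qed
  show "finite (vec_of_list ` {xs :: 'a list. set xs \<subseteq> UNIV \<and> length xs = k})"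
    by (intro finite_imageI finite_lists_length_eq) simp
qed

lemma lin_subspaces_subset: "W \<in> lin_subspaces k r \<Longrightarrow> W \<subseteq> carrier_vec k"
  unfolding lin_subspaces_def subspace_def submodule_def by (auto simp: module_vec_simps)

lemma finite_lin_subspaces: "finite (lin_subspaces k r :: 'a::{field,finite} vec set set)"
  by (rule finite_subset[of _ "Pow (carrier_vec k)"])
    (auto dest: lin_subspaces_subset simp: finite_carrier_vec)

text \<open>Over a finite field \<open>W\<close> is a finite generating set of itself, so it has a
  finite basis. The span is the same whether taken in \<open>W\<close> or in the ambient
  space.\<close>

lemma lin_subspaces_obtain_basis:
  assumes W: "W \<in> (lin_subspaces k r :: 'a::{field,finite} vec set set)"
  obtains B where "finite B" "B \<subseteq> carrier_vec k" "card B = r"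
    "LinearCombinations.module.span class_ring (module_vec TYPE('a) k) B = W"
proof -
  interpret V: vec_space "TYPE('a)" k .
  have sub: "subspace class_ring W V.V"
    and dim: "vectorspace.dim class_ring (V.V\<lparr>carrier := W\<rparr>) = r"
    using W unfolding lin_subspaces_def by auto
  have Wk: "W \<subseteq> carrier_vec k" by (rule lin_subspaces_subset[OF W])
  have subm: "submodule class_ring W V.V" using sub by (simp add: subspace_def)
  interpret W: vectorspace class_ring "V.V\<lparr>carrier := W\<rparr>"
    by (rule V.subspace_is_vs[OF sub])
  have finW: "finite W" using Wk finite_carrier_vec finite_subset by blast
  have "W.span W = W" 
    using W.in_own_span[of W] W.span_is_subset2[of W] by auto
  then have "W.fin_dim" unfolding W.fin_dim_def using finW by (intro exI[of _ W]) auto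
  then obtain B where B: "finite B" "W.basis B" using W.finite_basis_exists by blast
  then have BW: "B \<subseteq> W" and "W.span B = W" by (auto simp: W.basis_def)
  then have "V.span B = W" using V.span_li_not_depend(1)[OF BW subm] by simp
  moreover have "card B = r" using W.dim_basis[OF B] dim by simp
  ultimately show thesis using that[of B] B(1) BW Wk by auto
qed

text \<open>Rank-nullity for a functional that is onto a one-dimensional space.\<close>

lemma vec_hyperplane_in_PG_hyperplanes:
  fixes c :: "'a::field vec"
  assumes c: "c \<in> carrier_vec k" and c0: "c \<noteq> 0\<^sub>v k"
  shows "vec_hyperplane k c \<in> PG_hyperplanes k"
proof -
  interpret V: vec_space "TYPE('a)" k .
  interpret U: vec_space "TYPE('a)" 1 .
  \<comment> \<open>The functional takes values in vectors of length 1, so that its codomain is a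
    vector space of the same kind as its domain.\<close>
  let ?T = "\<lambda>x. vec 1 (\<lambda>_. c \<bullet> x)"
  interpret L: linear_map class_ring V.V U.V ?T
  proof (unfold_locales, goal_cases)
    case 1
    show ?case
      unfolding LinearCombinations.module_hom_def 
      by (auto simp: module_vec_simps class_ring_simps scalar_prod_add_distrib[OF c] 
        scalar_prod_smult_distrib[OF c])
  qed
  have ker: "L.kerT = vec_hyperplane k c"
    unfolding L.ker_def vec_hyperplane_def by (auto simp: module_vec_simps vec_eq_iff)
  obtain i where i: "i < k" "c $ i \<noteq> 0" using c c0 by (metis carrier_vecD eq_vecI index_zero_vec)
  have im: "L.imT = carrier_vec 1"
  proof -
    have "y \<in> L.imT" if y: "y \<in> carrier_vec 1" for y
    proof -
      have "y = ?T ((y $ 0 / c $ i) \<cdot>\<^sub>v unit_vec k i)"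
        using y c i by (auto simp: vec_eq_iff)
      then show ?thesis unfolding L.im_def by (auto simp: module_vec_simps)
    qed
    then show ?thesis unfolding L.im_def by (auto simp: module_vec_simps)
  qed
  \<comment> \<open>Rank-nullity speaks of the image as a space with replaced carrier; here the
    image is everything.\<close>
  have "U.V\<lparr>carrier := carrier_vec 1\<rparr> = U.V" by (simp add: module_vec_def)
  then have "1 + vectorspace.dim class_ring (V.V\<lparr>carrier := vec_hyperplane k c\<rparr>) = k"
    using L.rank_nullity[OF V.fin_dim] U.dim_is_n V.dim_is_n unfolding ker im by simp
  moreover have "subspace class_ring (vec_hyperplane k c) V.V"
    using L.kerT_is_subspace unfolding ker .
  ultimately show ?thesis unfolding PG_hyperplanes_def lin_subspaces_def by auto
qed

text \<open>The vectors, padded with zero rows, form a square matrix whose row \<open>j\<close> is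
  zero. Its determinant vanishes, so its kernel contains a nonzero \<open>c\<close>.\<close>

lemma exists_common_annihilator:
  fixes v :: "nat \<Rightarrow> 'a::field vec"
  assumes "j < k" and v: "\<And>i. i < j \<Longrightarrow> v i \<in> carrier_vec k"
  shows "\<exists>c \<in> carrier_vec k. c \<noteq> 0\<^sub>v k \<and> (\<forall>i<j. c \<bullet> v i = 0)"
proof -
  define r where "r i = (if i < j then v i else 0\<^sub>v k)" for i
  define M where "M = mat\<^sub>r k k r"
  have M: "M \<in> carrier_mat k k" by (simp add: M_def)
  have r: "r i \<in> carrier_vec k" for i by (simp add: r_def v)
  have "det M = det (mat\<^sub>r k k (\<lambda>i. if i = j then 0\<^sub>v k else r i))"
    unfolding M_def by (intro arg_cong[of _ _ det] arg_cong[of _ _ "mat\<^sub>r k k"]) (auto simp: r_def)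
  also have "\<dots> = 0" by (rule det_row_0[OF assms(1)]) (use r in auto)
  finally have "det M = 0" .
  then obtain c where c: "c \<in> carrier_vec k" "c \<noteq> 0\<^sub>v k" "M *\<^sub>v c = 0\<^sub>v k"
    using det_0_iff_vec_prod_zero_field[OF M] by blast
  have "c \<bullet> v i = 0" if i: "i < j" for i
  proof -
    have ik: "i < k" using i assms(1) by simp
    have "row M i = r i" unfolding M_def using ik r by (simp add: row_mat_of_row_fun)
    then have "(M *\<^sub>v c) $ i = v i \<bullet> c" using ik M i by (simp add: r_def)
    then show ?thesis using c ik v[OF i] by (simp add: comm_scalar_prod)
  qed
  then show ?thesis using c by blast
qed

text \<open>A basis of \<open>H\<close> has only \<open>k - 1\<close> elements, so some nonzero
  \<open>c\<close> annihilates it, and hence its span. Inclusion suffices for upper bounds on the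
  number of points on \<open>H\<close>.\<close>

lemma PG_hyperplane_subset_vec_hyperplane:
  fixes H :: "'a::{field,finite} vec set"
  assumes H: "H \<in> PG_hyperplanes k" and k: "k \<ge> 1"
  obtains c where "c \<in> carrier_vec k" "c \<noteq> 0\<^sub>v k" "H \<subseteq> vec_hyperplane k c"
proof -
  interpret V: vec_space "TYPE('a)" k .
  obtain B where B: "finite B" "B \<subseteq> carrier_vec k" "card B = k - 1" and span: "V.span B = H"
    using lin_subspaces_obtain_basis[OF H[unfolded PG_hyperplanes_def]] by blast
  obtain b where b: "b ` {..<k - 1} = B" 
    using ex_bij_betw_nat_finite[OF B(1)] B(3) by (auto simp: bij_betw_def atLeast0LessThan)
  obtain c where c: "c \<in> carrier_vec k" "c \<noteq> 0\<^sub>v k" "\<And>i. i < k - 1 \<Longrightarrow> c \<bullet> b i = 0"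
    using exists_common_annihilator[of "k - 1" k b] k b B(2) by force
  have "c \<in> V.orthogonal_complement B" unfolding V.orthogonal_complement_def using c b by auto
  then have "c \<in> V.orthogonal_complement H"
    using V.in_orthogonal_complement_span[OF B(2)] span by simp
  then have "H \<subseteq> vec_hyperplane k c"
    using lin_subspaces_subset H unfolding PG_hyperplanes_def V.orthogonal_complement_def vec_hyperplane_def
    by fastforce
  then show thesis using that c by blast
qed

lemma (in vec_space) span_singleton: 
  assumes v: "v \<in> carrier_vec n"
  shows "span {v} = vec_line v"
proof -
  have "span {v} = {lincomb a {v} | a. True}" using finite_span[of "{v}"] v by auto
  also have "\<dots> = {a v \<cdot>\<^sub>v v | a. True}" using v by (simp add: lincomb_def)
  also have "\<dots> = vec_line v" unfolding vec_line_def
    by (auto intro: exI[of _ "\<lambda>_. _"])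
  finally show ?thesis .
qed

lemma vec_line_in_PG_points:
  fixes v :: "'a::field vec"
  assumes v: "v \<in> carrier_vec k" "v \<noteq> 0\<^sub>v k"
  shows "vec_line v \<in> PG_points k"
proof -
  interpret V: vec_space "TYPE('a)" k .
  have sub: "subspace class_ring (vec_line v) V.V"
    using V.span_is_subspace[of "{v}"] v by (simp add: V.span_singleton)
  interpret W: vectorspace class_ring "V.V\<lparr>carrier := vec_line v\<rparr>"
    by (rule V.subspace_is_vs[OF sub])
  have vin: "{v} \<subseteq> vec_line v" unfolding vec_line_def by (auto intro: range_eqI[of _ _ 1])
  have "W.span {v} = vec_line v"
    using V.span_li_not_depend(1)[OF vin] sub V.span_singleton[OF v(1)] by (simp add: subspace_def)
  then have "W.dim = 1" using W.dim1I[of v] v vin by (auto simp: module_vec_simps)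
  then show ?thesis using sub unfolding PG_points_def lin_subspaces_def by simp
qed

lemma PG_points_eq_vec_line:
  fixes P :: "'a::{field,finite} vec set"
  assumes P: "P \<in> PG_points k"
  obtains v where "v \<in> carrier_vec k" "v \<noteq> 0\<^sub>v k" "P = vec_line v"
proof -
  interpret V: vec_space "TYPE('a)" k .
  obtain B where B: "B \<subseteq> carrier_vec k" "card B = 1" and span: "V.span B = P"
    using lin_subspaces_obtain_basis[OF P[unfolded PG_points_def]] by blast
  obtain v where v: "B = {v}" using B(2) card_1_singletonE by blast
  have "P = vec_line v" using span v B(1) V.span_singleton by auto
  moreover have "v \<noteq> 0\<^sub>v k"
  \<comment> \<open>If \<open>v\<close> were zero, \<open>P\<close> would be the zero space, of
    dimension 0 instead of 1.\<close>
  proof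
    assume "v = 0\<^sub>v k"
    then have P0: "P = {0\<^sub>v k}" using \<open>P = vec_line v\<close> by (auto simp: vec_line_def)
    have sub: "subspace class_ring P V.V" and d: "vectorspace.dim class_ring (V.V\<lparr>carrier := P\<rparr>) = 1"
      using P unfolding PG_points_def lin_subspaces_def by auto
    interpret W: vectorspace class_ring "V.V\<lparr>carrier := P\<rparr>"
      by (rule V.subspace_is_vs[OF sub])
    have "W.gen_set {\<zero>\<^bsub>V.V\<lparr>carrier := P\<rparr>\<^esub>}"
      using W.in_own_span[of P] W.span_is_subset2[of P] P0 by (auto simp: module_vec_simps)
    then show False using W.dim0I d by simp
  qed
  ultimately show thesis using that v B by auto
qed

lemma vec_line_subset_vec_hyperplane_iff:
  assumes "v \<in> carrier_vec k" "c \<in> carrier_vec k"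
  shows "vec_line v \<subseteq> vec_hyperplane k c \<longleftrightarrow> c \<bullet> v = 0"
proof
  assume "vec_line v \<subseteq> vec_hyperplane k c"
  then have "1 \<cdot>\<^sub>v v \<in> vec_hyperplane k c" unfolding vec_line_def by blast
  then show "c \<bullet> v = 0" by (simp add: vec_hyperplane_def)
qed (use assms in \<open>auto simp: vec_line_def vec_hyperplane_def\<close>)

lemma vec_line_smult:
  assumes "a \<noteq> 0"
  shows "vec_line (a \<cdot>\<^sub>v v) = vec_line (v :: 'a::field vec)"
proof -
  have "(\<lambda>b. b \<cdot>\<^sub>v (a \<cdot>\<^sub>v v)) ` UNIV = (\<lambda>b. b \<cdot>\<^sub>v v) ` ((\<lambda>b. b * a) ` UNIV)"
    by (simp add: image_image smult_smult_assoc)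
  moreover have "(\<lambda>b. b * a) ` UNIV = UNIV"
    using assms by (auto intro: image_eqI[of _ _ "_ / a"])
  ultimately show ?thesis unfolding vec_line_def by simp
qed

lemma vec_line_subset_imp_eq:
  fixes v w :: "'a::field vec"
  assumes "w \<in> carrier_vec k" "v \<noteq> 0\<^sub>v k" "vec_line v \<subseteq> vec_line w"
  shows "vec_line v = vec_line w"
proof -
  have "v \<in> vec_line v" unfolding vec_line_def by (auto intro: range_eqI[of _ _ 1])
  then obtain a where a: "v = a \<cdot>\<^sub>v w" using assms(3) unfolding vec_line_def by blast
  then have "a \<noteq> 0" using assms(1,2) by auto
  then show ?thesis using a vec_line_smult by simp
qed

lemma PG_points_subset_imp_eq:
  fixes P Q :: "'a::{field,finite} vec set"
  assumes "P \<in> PG_points k" "Q \<in> PG_points k" "P \<subseteq> Q"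
  shows "P = Q"
proof -
  obtain v where v: "v \<noteq> 0\<^sub>v k" "P = vec_line v" using PG_points_eq_vec_line[OF assms(1)] by blast
  obtain w where w: "w \<in> carrier_vec k" "Q = vec_line w" using PG_points_eq_vec_line[OF assms(2)] by blast
  show ?thesis using vec_line_subset_imp_eq[OF w(1) v(1)] v w assms(3) by simp
qed

section \<open>Dual systems\<close>

text \<open>A biorthogonal system, with functionals written as vectors. For \<open>m = k\<close> it
  is a basis with its dual basis; smaller \<open>m\<close> serve the inductive construction and
  truncation.\<close>

definition dual_system :: "nat \<Rightarrow> nat \<Rightarrow> (nat \<Rightarrow> 'a::field vec) \<Rightarrow> (nat \<Rightarrow> 'a vec) \<Rightarrow> bool" where
  "dual_system k m v f \<longleftrightarrow>
     (\<forall>i<m. v i \<in> carrier_vec k \<and> f i \<in> carrier_vec k) \<and>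
     (\<forall>i<m. \<forall>j<m. f i \<bullet> v j = (if i = j then 1 else 0))"

lemma dual_systemD:
  assumes "dual_system k m v f"
  shows "i < m \<Longrightarrow> v i \<in> carrier_vec k" "i < m \<Longrightarrow> f i \<in> carrier_vec k"
    "i < m \<Longrightarrow> j < m \<Longrightarrow> f i \<bullet> v j = (if i = j then 1 else 0)"
  using assms by (auto simp: dual_system_def)

text \<open>Induction on \<open>m\<close>: a functional killing the vectors chosen so far is nonzero
  at some \<open>x\<close> in \<open>S\<close>, and \<open>x\<close> becomes the next vector.
  Starting from \<open>p\<close> keeps a prescribed element at index 0.\<close>

lemma dual_system_exists:
  fixes S :: "'a::field vec set"
  assumes S: "S \<subseteq> carrier_vec k"
    and spanning: "\<And>c. c \<in> carrier_vec k \<Longrightarrow> c \<noteq> 0\<^sub>v k \<Longrightarrow> \<exists>x\<in>S. c \<bullet> x \<noteq> 0"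
    and p: "p \<in> S" "p \<noteq> 0\<^sub>v k"
    and m: "1 \<le> m" "m \<le> k"
  shows "\<exists>v f. dual_system k m v f \<and> v 0 = p \<and> (\<forall>i<m. v i \<in> S)"
  using m
proof (induction m rule: nat_induct_at_least)
  case base
  have pk: "p \<in> carrier_vec k" using p S by auto
  obtain i where i: "i < k" "p $ i \<noteq> 0"
    using p pk by (metis carrier_vecD eq_vecI index_zero_vec)
  have "dual_system k 1 (\<lambda>_. p) (\<lambda>_. (1 / p $ i) \<cdot>\<^sub>v unit_vec k i)"
    unfolding dual_system_def using pk i by simp
  then show ?case using p by fastforce
next
  case (Suc m)
  then obtain v f where d: "dual_system k m v f" and v0: "v 0 = p" and vS: "\<forall>i<m. v i \<in> S"
    by auto
  note d = dual_systemD[OF d]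
  obtain c where c: "c \<in> carrier_vec k" "c \<noteq> 0\<^sub>v k" "\<forall>i<m. c \<bullet> v i = 0"
    using exists_common_annihilator[of m k v] Suc.prems d(1) by auto
  obtain x where x: "x \<in> S" "c \<bullet> x \<noteq> 0" using spanning c by blast
  have xk: "x \<in> carrier_vec k" using x S by auto
  define g where "g = (1 / (c \<bullet> x)) \<cdot>\<^sub>v c"
  have g: "g \<in> carrier_vec k" "g \<bullet> x = 1" "\<And>i. i < m \<Longrightarrow> g \<bullet> v i = 0"
    unfolding g_def using c x xk d(1) by auto
  \<comment> \<open>The old functionals are corrected by a multiple of \<open>g\<close> so as to
    vanish at \<open>x\<close>; since \<open>g\<close> kills the old vectors, their values there do
    not change.\<close>
  define f' where "f' i = (if i < m then f i - (f i \<bullet> x) \<cdot>\<^sub>v g else g)" for i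
  define v' where "v' = v(m := x)"
  have "dual_system k (Suc m) v' f'"
    unfolding dual_system_def
  proof (intro conjI allI impI)
    fix i assume "i < Suc m"
    then show "v' i \<in> carrier_vec k" "f' i \<in> carrier_vec k"
      using d(1,2) g xk by (auto simp: v'_def f'_def less_Suc_eq)
    fix j assume "j < Suc m"
    have *: "(f i - (f i \<bullet> x) \<cdot>\<^sub>v g) \<bullet> y = f i \<bullet> y - (f i \<bullet> x) * (g \<bullet> y)"
      if "i < m" "y \<in> carrier_vec k" for y
      using that d(2)[of i] g by (simp add: minus_scalar_prod_distrib[of _ k])
    show "f' i \<bullet> v' j = (if i = j then 1 else 0)"
      using \<open>i < Suc m\<close> \<open>j < Suc m\<close> d g xk *
      by (auto simp: v'_def f'_def less_Suc_eq)
  qed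
  moreover have "v' 0 = p" "\<forall>i<Suc m. v' i \<in> S"
    using v0 vS x Suc.hyps by (auto simp: v'_def less_Suc_eq)
  ultimately show ?case by blast
qed

lemma dual_system_nonzero_coeff:
  assumes d: "dual_system k m v f" and "c \<in> carrier_vec k" "j < m" "c \<bullet> v j \<noteq> 0"
  shows "c \<noteq> 0\<^sub>v k"
  using assms dual_systemD(1)[OF d] by auto

text \<open>Duality says that the matrix of functionals times that of vectors is the identity. Both
  are square, so the product in the other order is the identity too, and it recovers
  \<open>x\<close> from its zero coordinates.\<close>

lemma dual_system_complete:
  fixes v f :: "nat \<Rightarrow> 'a::field vec"
  assumes d: "dual_system k k v f" and x: "x \<in> carrier_vec k" and 0: "\<And>i. i < k \<Longrightarrow> f i \<bullet> x = 0"
  shows "x = 0\<^sub>v k"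
proof -
  note d = dual_systemD[OF d]
  define F where "F = mat\<^sub>r k k f"
  define M where "M = mat\<^sub>r k k v"
  have F: "F \<in> carrier_mat k k" and M: "transpose_mat M \<in> carrier_mat k k"
    by (simp_all add: F_def M_def)
  have rowF: "row F i = f i" if "i < k" for i
    using that d(2) unfolding F_def by simp
  have colM: "col (transpose_mat M) i = v i" if "i < k" for i
    using that d(1) unfolding M_def by simp
  have "F * transpose_mat M = 1\<^sub>m k"
    by (rule eq_matI) (use F M rowF colM d(3) in auto)
  then have "transpose_mat M * F = 1\<^sub>m k" by (rule mat_mult_left_right_inverse[OF F M])
  then have "x = transpose_mat M *\<^sub>v (F *\<^sub>v x)"
    using assoc_mult_mat_vec[OF M F x] x by simp
  also have "F *\<^sub>v x = 0\<^sub>v k"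
    by (rule eq_vecI) (use F rowF 0 in auto)
  finally show ?thesis using M by (auto simp: mult_mat_vec_def scalar_prod_def)
qed

text \<open>The functional \<open>f i\<close> vanishes on every line of the system except the one at
  \<open>i\<close>.\<close>

lemma inj_on_dual_system_line:
  assumes d: "dual_system k m v f"
  shows "inj_on (\<lambda>i. vec_line (v i)) {..<m}"
proof (rule inj_onI)
  fix i j assume ij: "i \<in> {..<m}" "j \<in> {..<m}" and eq: "vec_line (v i) = vec_line (v j)"
  note d = dual_systemD[OF d]
  have "f i \<bullet> v j = 0 \<longleftrightarrow> f i \<bullet> v i = 0"
    using vec_line_subset_vec_hyperplane_iff[of "v j" k "f i"]
      vec_line_subset_vec_hyperplane_iff[of "v i" k "f i"] d ij eq by simp
  then show "i = j" using d ij by (auto split: if_splits)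
qed

section \<open>Counting points on hyperplanes\<close>

lemma size_points_on_mono: "A \<subseteq># B \<Longrightarrow> size (points_on A H) \<le> size (points_on B H)"
  unfolding points_on_def by (simp add: multiset_filter_mono size_mset_mono)

lemma size_points_on_subset: "H \<subseteq> H' \<Longrightarrow> size (points_on G H) \<le> size (points_on G H')"
  unfolding points_on_def by (intro size_mset_mono mset_subset_eqI) (simp, blast)

lemma size_points_on_add_mset:
  "size (points_on (add_mset P G) H) = (if P \<subseteq> H then 1 else 0) + size (points_on G H)"
  by (simp add: points_on_def)

lemma size_points_on_lines:
  fixes v :: "nat \<Rightarrow> 'a::field vec"
  assumes "\<And>i. i < m \<Longrightarrow> v i \<in> carrier_vec k" "c \<in> carrier_vec k"
  shows "size (points_on {#vec_line (v i). i \<in># mset_set {..<m}#} (vec_hyperplane k c))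
    = card {i. i < m \<and> c \<bullet> v i = 0}"
proof -
  have "filter_mset (\<lambda>i. vec_line (v i) \<subseteq> vec_hyperplane k c) (mset_set {..<m})
    = filter_mset (\<lambda>i. c \<bullet> v i = 0) (mset_set {..<m})"
    using assms by (intro filter_mset_cong) (simp_all add: vec_line_subset_vec_hyperplane_iff)
  moreover have "{i \<in> {..<m}. c \<bullet> v i = 0} = {i. i < m \<and> c \<bullet> v i = 0}" by auto
  ultimately show ?thesis by (simp add: points_on_def filter_mset_image_mset)
qed

lemma size_filter_partition:
  "size G = size (filter_mset Q G) + size {#x \<in># G. \<not> Q x#}"
  by (metis multiset_partition size_union)

text \<open>Union bound with multiplicities, for covering the code by hyperplanes.\<close>

lemma size_le_sum_size_filter:
  assumes "finite I" "\<And>x. x \<in># G \<Longrightarrow> \<exists>i\<in>I. Q i x"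
  shows "size G \<le> (\<Sum>i\<in>I. size (filter_mset (Q i) G))"
  using assms(2)
proof (induction G)
  case (add x G)
  then obtain i where i: "i \<in> I" "Q i x" by auto
  have "1 \<le> (\<Sum>i\<in>I. if Q i x then 1 else 0 :: nat)"
    using member_le_sum[of i I "\<lambda>i. if Q i x then 1 else 0 :: nat"] i assms(1) by simp
  moreover have "(\<Sum>i\<in>I. size (filter_mset (Q i) (add_mset x G)))
    = (\<Sum>i\<in>I. if Q i x then 1 else 0) + (\<Sum>i\<in>I. size (filter_mset (Q i) G))"
    unfolding sum.distrib[symmetric] by (rule sum.cong) auto
  moreover have "size G \<le> (\<Sum>i\<in>I. size (filter_mset (Q i) G))" using add by auto
  ultimately show ?case by simp
qed simp

section \<open>Codes as projective systems\<close>

lemma PG_hyperplanes_nonempty: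
  assumes "k \<ge> 1"
  shows "(PG_hyperplanes k :: 'a::field vec set set) \<noteq> {}"
  using vec_hyperplane_in_PG_hyperplanes[of "unit_vec k 0 :: 'a vec" k] assms by auto

lemma finite_PG_hyperplanes: "finite (PG_hyperplanes k :: 'a::{field,finite} vec set set)"
  unfolding PG_hyperplanes_def by (rule finite_lin_subspaces)

lemma linear_code_hyperplane_bound:
  assumes "linear_code n k d G" "H \<in> PG_hyperplanes k"
  shows "size (points_on G H) + d \<le> n"
proof -
  have "size (points_on G H) \<le> (MAX H \<in> PG_hyperplanes k. size (points_on G H))"
    using assms(2) finite_PG_hyperplanes by (intro Max_ge) auto
  then show ?thesis using assms(1) unfolding linear_code_def by linarith
qed

text \<open>Defect \<open>s\<close> means \<open>n - d = k - 1 + s\<close>; the 1 is moved to the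
  left to avoid truncated subtraction.\<close>

lemma AsMDS_code_hyperplane_bound:
  fixes G :: "'a::{field,finite} vec set multiset"
  assumes G: "AsMDS_code s n k d G" and c: "c \<in> carrier_vec k" "c \<noteq> 0\<^sub>v k"
  shows "size (points_on G (vec_hyperplane k c)) + 1 \<le> k + s"
  using linear_code_hyperplane_bound[of n k d G, OF _ vec_hyperplane_in_PG_hyperplanes[OF c]] G
  unfolding AsMDS_code_def singleton_defect_def by linarith

lemma linear_code_max_hyperplane:
  fixes G :: "'a::{field,finite} vec set multiset"
  assumes "linear_code n k d G" "k \<ge> 1"
  obtains H where "H \<in> PG_hyperplanes k" "size (points_on G H) + d = n"
proof -
  let ?A = "(\<lambda>H. size (points_on G H)) ` (PG_hyperplanes k :: 'a vec set set)"
  have "Max ?A \<in> ?A" 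
    using PG_hyperplanes_nonempty[OF assms(2)] finite_PG_hyperplanes by (intro Max_in) auto
  then obtain H :: "'a vec set" where H: "H \<in> PG_hyperplanes k" "size (points_on G H) = Max ?A" by auto
  then have "size (points_on G H) + d = n" using assms(1) unfolding linear_code_def by linarith
  then show thesis using that H by blast
qed

lemma linear_codeI:
  fixes G :: "'a::{field,finite} vec set multiset"
  assumes "set_mset G \<subseteq> PG_points k"
    and "\<And>H. H \<in> PG_hyperplanes k \<Longrightarrow> \<exists>P\<in>#G. \<not> P \<subseteq> H"
    and "\<And>H. H \<in> PG_hyperplanes k \<Longrightarrow> size (points_on G H) + d \<le> size G"
    and H: "H \<in> PG_hyperplanes k" "size (points_on G H) + d = size G"
  shows "linear_code (size G) k d G"
proof -
  have "(MAX H \<in> PG_hyperplanes k. size (points_on G H)) = size (points_on G H)"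
    by (rule Max_eqI) (use assms finite_PG_hyperplanes in fastforce)+
  then show ?thesis unfolding linear_code_def using assms by force
qed

text \<open>Not lying in a hyperplane is the spanning condition of
  \<open>dual_system_exists\<close>. The given point is placed at index 0, where later arguments
  count it twice.\<close>

lemma linear_code_dual_system:
  fixes G :: "'a::{field,finite} vec set multiset"
  assumes G: "linear_code n k d G" and k: "k \<ge> 1" and P: "P \<in># G"
  obtains v f where "dual_system k k v f" "vec_line (v 0) = P" "\<And>i. i < k \<Longrightarrow> vec_line (v i) \<in># G"
proof -
  define S where "S = {x \<in> carrier_vec k. vec_line x \<in># G}"
  have pts: "set_mset G \<subseteq> PG_points k" using G by (simp add: linear_code_def)
  obtain p where p: "p \<in> carrier_vec k" "p \<noteq> 0\<^sub>v k" "P = vec_line p"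
    using PG_points_eq_vec_line P pts by blast
  have "\<exists>x\<in>S. c \<bullet> x \<noteq> 0" if c: "c \<in> carrier_vec k" "c \<noteq> 0\<^sub>v k" for c
  proof -
    obtain Q where Q: "Q \<in># G" "\<not> Q \<subseteq> vec_hyperplane k c"
      using G vec_hyperplane_in_PG_hyperplanes[OF c] unfolding linear_code_def by blast
    obtain x where "x \<in> carrier_vec k" "Q = vec_line x" using PG_points_eq_vec_line Q pts by blast
    then show ?thesis using Q c vec_line_subset_vec_hyperplane_iff[of x k c] unfolding S_def by auto
  qed
  then obtain v f where "dual_system k k v f" "v 0 = p" "\<forall>i<k. v i \<in> S"
    using dual_system_exists[of S k p k] p P k unfolding S_def by blast
  then show thesis using that[of v f] p unfolding S_def by auto
qed

lemma dual_system_lines_subseteq: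
  assumes d: "dual_system k m v f" and "\<And>i. i < m \<Longrightarrow> vec_line (v i) \<in># G"
  shows "{#vec_line (v i). i \<in># mset_set {..<m}#} \<subseteq># G"
proof -
  have "{#vec_line (v i). i \<in># mset_set {..<m}#} = mset_set ((\<lambda>i. vec_line (v i)) ` {..<m})"
    by (rule image_mset_mset_set[OF inj_on_dual_system_line[OF d]])
  also have "\<dots> \<subseteq># mset_set (set_mset G)"
    using assms(2) by (intro subset_imp_msubset_mset_set) auto
  also have "\<dots> \<subseteq># G" by (rule mset_set_set_mset_msubset)
  finally show ?thesis .
qed

text \<open>The lines of a dual system are distinct, so only the line at index 0 needs multiplicity
  2 in \<open>G\<close>.\<close>

lemma dual_system_repeated_line_subseteq:
  assumes d: "dual_system k m v f" and "\<And>i. i < m \<Longrightarrow> vec_line (v i) \<in># G"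
    and "0 < m" "count G (vec_line (v 0)) \<ge> 2"
  shows "add_mset (vec_line (v 0)) {#vec_line (v i). i \<in># mset_set {..<m}#} \<subseteq># G"
proof -
  have eq: "{#vec_line (v i). i \<in># mset_set {..<m}#} = mset_set ((\<lambda>i. vec_line (v i)) ` {..<m})"
    by (rule image_mset_mset_set[OF inj_on_dual_system_line[OF d]])
  show ?thesis
  proof (rule mset_subset_eqI)
    fix a
    show "count (add_mset (vec_line (v 0)) {#vec_line (v i). i \<in># mset_set {..<m}#}) a \<le> count G a"
      using assms(2-4) unfolding eq by (auto simp: count_mset_set' Suc_le_eq)
  qed
qed

text \<open>The kernel of one dual basis functional contains the other \<open>k - 1\<close> basis
  points, so \<open>n - d\<close> is at least \<open>k - 1\<close>.\<close>

lemma singleton_bound: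
  fixes G :: "'a::{field,finite} vec set multiset"
  assumes G: "linear_code n k d G" and k: "k \<ge> 1"
  shows "k + d \<le> n + 1"
proof -
  obtain P where "P \<in># G" 
    using G PG_hyperplanes_nonempty[OF k] unfolding linear_code_def by blast
  then obtain v f where d: "dual_system k k v f" and vG: "\<And>i. i < k \<Longrightarrow> vec_line (v i) \<in># G"
    using linear_code_dual_system[OF G k] by metis
  note D = dual_systemD[OF d]
  let ?c = "f (k - 1)"
  have c: "?c \<in> carrier_vec k" "?c \<noteq> 0\<^sub>v k"
    using D k dual_system_nonzero_coeff[OF d, of ?c "k - 1"] by auto
  have "{i. i < k \<and> ?c \<bullet> v i = 0} = {..<k - 1}" using D(3)[of "k - 1"] k by (auto split: if_splits)
  then have "k - 1 \<le> size (points_on G (vec_hyperplane k ?c))"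
    using size_points_on_mono[OF dual_system_lines_subseteq[OF d vG]]
      size_points_on_lines[of k v k ?c] D c by (metis card_lessThan)
  then show ?thesis
    using linear_code_hyperplane_bound[OF G vec_hyperplane_in_PG_hyperplanes[OF c]] by linarith
qed

section \<open>Codes with a repeated point\<close>

lemma not_projective_codeE:
  assumes "\<not> projective_code G"
  obtains P where "P \<in># G" "count G P \<ge> 2"
proof -
  obtain P where P: "P \<in># G" "count G P \<noteq> 1" using assms unfolding projective_code_def by blast
  then have "count G P \<noteq> 0" by simp
  then have "count G P \<ge> 2" using P(2) by linarith
  then show thesis using that P by blast
qed

lemma MDS_code_projective:
  fixes G :: "'a::{field,finite} vec set multiset"
  assumes G: "AsMDS_code 0 n k d G" and k: "k \<ge> 2"
  shows "projective_code G"
proof (rule ccontr)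
  assume "\<not> projective_code G"
  then obtain P where P: "P \<in># G" "count G P \<ge> 2" by (rule not_projective_codeE)
  have code: "linear_code n k d G" using G by (simp add: AsMDS_code_def)
  obtain v f where d: "dual_system k k v f" and v0: "vec_line (v 0) = P"
    and vG: "\<And>i. i < k \<Longrightarrow> vec_line (v i) \<in># G"
    using linear_code_dual_system[OF code _ P(1)] k by auto
  note D = dual_systemD[OF d]
  \<comment> \<open>As \<open>k\<close> is at least 2, the kernel of the last functional contains
    \<open>v 0\<close>, counted twice, and so at least \<open>k\<close> code points in all.\<close>
  let ?c = "f (k - 1)"
  have c: "?c \<in> carrier_vec k" "?c \<noteq> 0\<^sub>v k"
    using D k dual_system_nonzero_coeff[OF d, of ?c "k - 1"] by auto
  have "{i. i < k \<and> ?c \<bullet> v i = 0} = {..<k - 1}" using D(3)[of "k - 1"] k by (auto split: if_splits)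
  then have "size (points_on {#vec_line (v i). i \<in># mset_set {..<k}#} (vec_hyperplane k ?c)) = k - 1"
    using size_points_on_lines[of k v k ?c] D(1) c(1) by simp
  moreover have "vec_line (v 0) \<subseteq> vec_hyperplane k ?c"
    using D k c by (subst vec_line_subset_vec_hyperplane_iff) auto
  ultimately have "k \<le> size (points_on G (vec_hyperplane k ?c))"
    using size_points_on_mono[OF dual_system_repeated_line_subseteq[OF d vG], of "vec_hyperplane k ?c"]
      v0 P(2) k by (simp add: size_points_on_add_mset)
  then show False using AsMDS_code_hyperplane_bound[OF G c] by simp
qed

text \<open>On a projective line hyperplanes are points, so a hyperplane meets a projective code at
  most once and \<open>n - d\<close> is at most 1.\<close>

lemma projective_AsMDS_code_dim_2:
  fixes G :: "'a::{field,finite} vec set multiset"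
  assumes G: "AsMDS_code s n 2 d G" and proj: "projective_code G"
  shows "s = 0"
proof -
  have code: "linear_code n 2 d G" using G by (simp add: AsMDS_code_def)
  obtain H where H: "H \<in> PG_hyperplanes 2" "size (points_on G H) + d = n"
    using linear_code_max_hyperplane[OF code] by auto
  have HP: "H \<in> PG_points 2" using H(1) by (simp add: PG_hyperplanes_def PG_points_def)
  have "points_on G H = filter_mset (\<lambda>P. P = H) G"
    unfolding points_on_def
  proof (rule filter_mset_cong)
    fix P assume "P \<in># G"
    then have "P \<in> PG_points 2" using code by (auto simp: linear_code_def)
    then show "P \<subseteq> H \<longleftrightarrow> P = H" using PG_points_subset_imp_eq HP by blast
  qed simp
  then have "size (points_on G H) = count G H"
    by (simp add: filter_eq_replicate_mset)
  also have "\<dots> \<le> 1" using proj unfolding projective_code_def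
    by (cases "H \<in># G") (auto simp: not_in_iff)
  finally show ?thesis using H(2) G unfolding AsMDS_code_def singleton_defect_def by linarith
qed

section \<open>Hyperplanes through a subspace of codimension two\<close>

lemma AsMDS_code_not_projective_length_le:
  fixes G :: "'a::{field,finite} vec set multiset"
  assumes G: "AsMDS_code s n k d G" and k: "k \<ge> 3" and "\<not> projective_code G"
  shows "n \<le> s * (CARD('a) + 1) + k - 1"
proof -
  obtain P where P: "P \<in># G" "count G P \<ge> 2" using assms(3) by (rule not_projective_codeE)
  have code: "linear_code n k d G" using G by (simp add: AsMDS_code_def)
  have pts: "set_mset G \<subseteq> PG_points k" using code by (simp add: linear_code_def)
  obtain v f where d: "dual_system k k v f" and v0: "vec_line (v 0) = P"
    and vG: "\<And>i. i < k \<Longrightarrow> vec_line (v i) \<in># G"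
    using linear_code_dual_system[OF code _ P(1)] k by auto
  note D = dual_systemD[OF d]
  \<comment> \<open>The last two functionals are taken so that both vanish at \<open>v 0\<close>,
    since \<open>k\<close> is at least 3.\<close>
  define g h where "g = f (k - 1)" and "h = f (k - 2)"
  have g: "g \<in> carrier_vec k" and h: "h \<in> carrier_vec k" using D(2) k by (auto simp: g_def h_def)
  have gv: "g \<bullet> v i = (if i = k - 1 then 1 else 0)" and hv: "h \<bullet> v i = (if i = k - 2 then 1 else 0)"
    if "i < k" for i using D(3) that k unfolding g_def h_def by auto
  \<comment> \<open>the \<open>q + 1\<close> functionals vanishing on the common kernel of \<open>g\<close> and \<open>h\<close>, up to scaling\<close>
  define c :: "'a option \<Rightarrow> 'a vec" where
    "c z = (case z of None \<Rightarrow> g | Some a \<Rightarrow> h - a \<cdot>\<^sub>v g)" for z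
  have cx: "c z \<bullet> x = (case z of None \<Rightarrow> g \<bullet> x | Some a \<Rightarrow> h \<bullet> x - a * (g \<bullet> x))"
    if "x \<in> carrier_vec k" for z x
    using that g h by (auto simp: c_def minus_scalar_prod_distrib[of _ k] split: option.split)
  have ck: "c z \<in> carrier_vec k" for z using g h by (auto simp: c_def split: option.split)
  have c0: "c z \<noteq> 0\<^sub>v k" for z
  proof (cases z)
    case None
    have "c z \<bullet> v (k - 1) = 1" using None cx[OF D(1)] gv k by simp
    then show ?thesis using dual_system_nonzero_coeff[OF d ck, of "k - 1"] k by simp
  next
    case (Some a)
    have "c z \<bullet> v (k - 2) = 1" using Some cx[OF D(1)] gv hv k by simp
    then show ?thesis using dual_system_nonzero_coeff[OF d ck, of "k - 2"] k by simp
  qed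
  let ?L = "vec_hyperplane k g \<inter> vec_hyperplane k h"
  define l where "l = size (points_on G ?L)"
  have L_sub: "?L \<subseteq> vec_hyperplane k (c z)" for z
    using cx by (auto simp: vec_hyperplane_def split: option.split)
  have split: "size (points_on G (vec_hyperplane k (c z)))
      = l + size {#Q \<in># G. Q \<subseteq> vec_hyperplane k (c z) \<and> \<not> Q \<subseteq> ?L#}" for z
  proof -
    have "points_on G (vec_hyperplane k (c z))
      = {#Q \<in># G. Q \<subseteq> ?L#} + {#Q \<in># G. Q \<subseteq> vec_hyperplane k (c z) \<and> \<not> Q \<subseteq> ?L#}"
      unfolding points_on_def using L_sub[of z] by (intro multiset_eqI) auto
    then show ?thesis by (simp add: l_def points_on_def)
  qed
  \<comment> \<open>The points \<open>v 0\<close>, ..., \<open>v (k - 3)\<close> together with the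
    second copy of \<open>v 0\<close> make \<open>k - 1\<close>.\<close>
  have l_lower: "k - 1 \<le> l"
  proof -
    let ?F = "{#vec_line (v i). i \<in># mset_set {..<k - 2}#}"
    have d': "dual_system k (k - 2) v f" using d by (auto simp: dual_system_def)
    have in_L: "vec_line (v i) \<subseteq> ?L" if "i < k - 2" for i
      using that gv[of i] hv[of i] D(1)[of i] g h by (simp add: vec_line_subset_vec_hyperplane_iff)
    have "points_on (add_mset (vec_line (v 0)) ?F) ?L = add_mset (vec_line (v 0)) ?F"
      unfolding points_on_def filter_mset_eq_conv using in_L k by auto
    then have "size (points_on (add_mset (vec_line (v 0)) ?F) ?L) = k - 1" using k by simp
    moreover have "add_mset (vec_line (v 0)) ?F \<subseteq># G"
      using dual_system_repeated_line_subseteq[OF d', of G] vG k v0 P(2) by simp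
    ultimately show ?thesis using size_points_on_mono[of _ G ?L] unfolding l_def by metis
  qed
  have c_upper: "size (points_on G (vec_hyperplane k (c z))) + 1 \<le> k + s" for z
    by (rule AsMDS_code_hyperplane_bound[OF G ck c0])
  \<comment> \<open>The excess of \<open>l\<close> over its lower bound; each hyperplane of the
    pencil then has at most \<open>s - t\<close> code points outside \<open>?L\<close>.\<close>
  define t where "t = l - (k - 1)"
  have l: "l = k - 1 + t" using l_lower by (simp add: t_def)
  have ts: "t \<le> s" using split[of None] c_upper[of None] l by linarith
  have "\<exists>z. Q \<subseteq> vec_hyperplane k (c z)" if Q: "Q \<in># G" for Q
  proof -
    obtain x where x: "x \<in> carrier_vec k" "Q = vec_line x" using PG_points_eq_vec_line Q pts by blast
    \<comment> \<open>The member of the pencil through \<open>x\<close> is found by solving for the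
      parameter; \<open>None\<close> covers the points on the kernel of \<open>g\<close>.\<close>
    have "c (if g \<bullet> x = 0 then None else Some (h \<bullet> x / (g \<bullet> x))) \<bullet> x = 0"
      using cx[OF x(1)] by simp
    then show ?thesis using vec_line_subset_vec_hyperplane_iff[OF x(1) ck] x(2) by blast
  qed
  then have "size {#Q \<in># G. \<not> Q \<subseteq> ?L#}
    \<le> (\<Sum>z\<in>UNIV. size (filter_mset (\<lambda>Q. Q \<subseteq> vec_hyperplane k (c z)) {#Q \<in># G. \<not> Q \<subseteq> ?L#}))"
    by (intro size_le_sum_size_filter) auto
  also have "\<dots> \<le> (\<Sum>z\<in>(UNIV :: 'a option set). s - t)"
  proof (rule sum_mono)
    fix z
    have "filter_mset (\<lambda>Q. Q \<subseteq> vec_hyperplane k (c z)) {#Q \<in># G. \<not> Q \<subseteq> ?L#}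
      = {#Q \<in># G. Q \<subseteq> vec_hyperplane k (c z) \<and> \<not> Q \<subseteq> ?L#}"
      by (simp add: filter_filter_mset conj_commute)
    then show "size (filter_mset (\<lambda>Q. Q \<subseteq> vec_hyperplane k (c z)) {#Q \<in># G. \<not> Q \<subseteq> ?L#}) \<le> s - t"
      using split[of z] c_upper[of z] l by simp
  qed
  also have "\<dots> = (s - t) * (CARD('a) + 1)" by (simp add: card_UNIV_option)
  finally have "n \<le> l + (s - t) * (CARD('a) + 1)"
    using size_filter_partition[of G "\<lambda>Q. Q \<subseteq> ?L"] code
    unfolding l_def points_on_def linear_code_def by linarith
  \<comment> \<open>The excess \<open>t\<close> enters \<open>l\<close> once but is saved in each of
    the \<open>q + 1\<close> hyperplanes, so \<open>t = 0\<close> is the worst case.\<close>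
  moreover have "t + (s - t) * (CARD('a) + 1) \<le> t * (CARD('a) + 1) + (s - t) * (CARD('a) + 1)" by simp
  moreover have "\<dots> = s * (CARD('a) + 1)"
    using ts unfolding add_mult_distrib[symmetric] by simp
  ultimately show ?thesis using k l by linarith
qed

section \<open>Almost MDS codes of large dimension\<close>

lemma two_elements_subseteq_mset:
  assumes "size M \<ge> 2"
  obtains a b where "{#a, b#} \<subseteq># M"
proof -
  obtain a M' where M: "M = add_mset a M'" using assms by (cases M) auto
  then obtain b M'' where "M' = add_mset b M''" using assms by (cases M') auto
  then show thesis using that[of a b] M by simp
qed

lemma almost_MDS_code_not_projective_dim_le:
  fixes G :: "'a::{field,finite} vec set multiset"
  assumes G: "AsMDS_code 1 n k d G" and k: "k \<ge> 2" and n: "n > k + 2" and "\<not> projective_code G"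
  shows "k \<le> CARD('a)"
proof -
  obtain P where P: "P \<in># G" "count G P \<ge> 2" using assms(4) by (rule not_projective_codeE)
  have code: "linear_code n k d G" using G by (simp add: AsMDS_code_def)
  have pts: "set_mset G \<subseteq> PG_points k" using code by (simp add: linear_code_def)
  obtain v f where d: "dual_system k k v f" and v0: "vec_line (v 0) = P"
    and vG: "\<And>i. i < k \<Longrightarrow> vec_line (v i) \<in># G"
    using linear_code_dual_system[OF code _ P(1)] k by auto
  note D = dual_systemD[OF d]
  let ?F = "{#vec_line (v i). i \<in># mset_set {..<k}#}"
  let ?E = "add_mset (vec_line (v 0)) ?F"
  have E: "?E \<subseteq># G" using dual_system_repeated_line_subseteq[OF d vG] k v0 P(2) by simp
  \<comment> \<open>\<open>?E\<close> has \<open>k + 1\<close> elements and \<open>n\<close> is at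
    least \<open>k + 3\<close>.\<close>
  have "size (G - ?E) \<ge> 2"
    using size_Diff_submset[OF E] code n by (simp add: linear_code_def)
  then obtain U W where UW: "{#U, W#} \<subseteq># G - ?E" by (rule two_elements_subseteq_mset)
  then have UWE: "{#U, W#} + ?E \<subseteq># G" 
    using mset_subset_eq_mono_add[OF UW subset_mset.order_refl[of ?E]]
    by (simp only: subset_mset.diff_add[OF E])
  then have "U \<in># G" "W \<in># G" by (auto dest: mset_subset_eqD)
  then obtain u w where u: "u \<in> carrier_vec k" "U = vec_line u" and w: "w \<in> carrier_vec k" "W = vec_line w"
    using PG_points_eq_vec_line pts by (metis subsetD)
  \<comment> \<open>A hyperplane carries at most \<open>k - 1 + s = k\<close> code points. The
    separate summand for \<open>v 0\<close> is its second copy.\<close>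
  have count_le: "(if c \<bullet> u = 0 then 1 else 0) + (if c \<bullet> w = 0 then 1 else 0)
      + (if c \<bullet> v 0 = 0 then 1 else 0) + card {i. i < k \<and> c \<bullet> v i = 0} \<le> k"
    if c: "c \<in> carrier_vec k" "c \<noteq> 0\<^sub>v k" for c
  proof -
    have "size (points_on ({#U, W#} + ?E) (vec_hyperplane k c)) \<le> k"
      using size_points_on_mono[OF UWE, of "vec_hyperplane k c"] AsMDS_code_hyperplane_bound[OF G c] by simp
    moreover have "v 0 \<in> carrier_vec k" using D(1) k by simp
    ultimately show ?thesis
      using u w c D(1) size_points_on_lines[of k v k c]
      by (simp add: size_points_on_add_mset vec_line_subset_vec_hyperplane_iff)
  qed
  \<comment> \<open>For \<open>i\<close> different from 0 the kernel of \<open>f i\<close> already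
    has \<open>k\<close> points: \<open>k - 1\<close> basis points and the second copy of
    \<open>v 0\<close>. There is no room for \<open>u\<close> or \<open>w\<close>.\<close>
  have nz: "f i \<bullet> u \<noteq> 0" "f i \<bullet> w \<noteq> 0" if i: "i \<in> {1..<k}" for i
  proof -
    have "f i \<noteq> 0\<^sub>v k" using dual_system_nonzero_coeff[OF d, of "f i" i] D i by simp
    moreover have "{j. j < k \<and> f i \<bullet> v j = 0} = {..<k} - {i}" using D(3)[of i] i by (auto split: if_splits)
    then have "card {j. j < k \<and> f i \<bullet> v j = 0} = k - 1" using i by simp
    moreover have "f i \<bullet> v 0 = 0" using D(3)[of i 0] i by simp
    ultimately show "f i \<bullet> u \<noteq> 0" "f i \<bullet> w \<noteq> 0"
      using count_le[of "f i"] D(2)[of i] i by (auto split: if_splits)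
  qed
  have "inj_on (\<lambda>i. (f i \<bullet> w) / (f i \<bullet> u)) {1..<k}"
  proof (rule inj_onI, rule ccontr)
    fix i j assume i: "i \<in> {1..<k}" and j: "j \<in> {1..<k}" and ij: "i \<noteq> j"
      and eq: "(f i \<bullet> w) / (f i \<bullet> u) = (f j \<bullet> w) / (f j \<bullet> u)"
    \<comment> \<open>\<open>c\<close> vanishes at \<open>u\<close>, at \<open>w\<close>, at both copies of \<open>v 0\<close>, and at all other \<open>v l\<close> but \<open>v i\<close>, \<open>v j\<close>\<close>
    define c where "c = (f j \<bullet> u) \<cdot>\<^sub>v f i - (f i \<bullet> u) \<cdot>\<^sub>v f j"
    have fk: "f i \<in> carrier_vec k" "f j \<in> carrier_vec k" using D(2) i j by auto
    have ck: "c \<in> carrier_vec k" using fk by (simp add: c_def)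
    have cx: "c \<bullet> x = (f j \<bullet> u) * (f i \<bullet> x) - (f i \<bullet> u) * (f j \<bullet> x)" if "x \<in> carrier_vec k" for x
      using that fk by (simp add: c_def minus_scalar_prod_distrib[of _ k])
    have cv: "c \<bullet> v l = (if l = i then f j \<bullet> u else if l = j then - (f i \<bullet> u) else 0)" if "l < k" for l
      using that cx[OF D(1)[OF that]] D(3) i j ij by simp
    have "c \<noteq> 0\<^sub>v k" using dual_system_nonzero_coeff[OF d ck, of i] cv[of i] nz(1)[OF j] i by simp
    moreover have "{l. l < k \<and> c \<bullet> v l = 0} = {..<k} - {i, j}"
      using cv nz(1)[OF i] nz(1)[OF j] by (auto split: if_splits)
    then have "card {l. l < k \<and> c \<bullet> v l = 0} = k - 2" using i j ij by (simp add: card_Diff_subset)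
    moreover have "c \<bullet> v 0 = 0" using cv[of 0] i j by auto
    moreover have "c \<bullet> u = 0" using cx[OF u(1)] by simp
    moreover have "c \<bullet> w = 0" using cx[OF w(1)] eq nz(1)[OF i] nz(1)[OF j] by (simp add: field_simps)
    \<comment> \<open>The kernel of \<open>c\<close> would carry \<open>(k - 2) + 3 = k + 1\<close>
      code points.\<close>
    ultimately show False using count_le[OF ck] i j ij by simp
  qed
  moreover have "(\<lambda>i. (f i \<bullet> w) / (f i \<bullet> u)) ` {1..<k} \<subseteq> UNIV - {0}" using nz by auto
  ultimately have "card {1..<k} \<le> card (UNIV - {0 :: 'a})" by (intro card_inj_on_le) auto
  then have "k - 1 \<le> CARD('a) - 1" by (simp add: card_Diff_subset)
  moreover have "CARD('a) > 0" by simp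
  ultimately show ?thesis by linarith
qed

section \<open>Projection from a point\<close>

text \<open>Hyperplanes of the quotient by \<open>P\<close> pull back to hyperplanes through
  \<open>P\<close>, which lose exactly the \<open>count G P\<close> copies of \<open>P\<close>. The
  length drops by the same number, so the distance cannot decrease.\<close>

lemma linear_code_projection:
  fixes G :: "'a::{field,finite} vec set multiset"
  assumes G: "linear_code n (Suc k) d G" and k: "k \<ge> 1" and P: "P \<in># G"
  obtains d' G' where "linear_code (n - count G P) k d' (G' :: 'a vec set multiset)" "d \<le> d'"
proof -
  have pts: "set_mset G \<subseteq> PG_points (Suc k)" and sizeG: "size G = n"
    using G by (simp_all add: linear_code_def)
  have "Suc k \<ge> 1" by simp
  then obtain v f where dual: "dual_system (Suc k) (Suc k) v f" and v0: "vec_line (v 0) = P"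
    using linear_code_dual_system[OF G _ P] by blast
  note D = dual_systemD[OF dual]
  \<comment> \<open>Dropping the coordinate \<open>f 0\<close> realises the quotient map with kernel
    \<open>P\<close>; its transpose pulls functionals back.\<close>
  define A where "A = mat\<^sub>r k (Suc k) (\<lambda>i. f (Suc i))"
  have A: "A \<in> carrier_mat k (Suc k)" by (simp add: A_def)
  have row: "row A i = f (Suc i)" if "i < k" for i
    using that D(2)[of "Suc i"] unfolding A_def by simp
  have Ax: "(A *\<^sub>v x) $ i = f (Suc i) \<bullet> x" if "i < k" for x i
    using that row A by simp
  have line_image: "(*\<^sub>v) A ` vec_line x = vec_line (A *\<^sub>v x)" if "x \<in> carrier_vec (Suc k)" for x
    using that mult_mat_vec[OF A] unfolding vec_line_def by (simp add: image_image)
  have A_eq_0: "vec_line x = P"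
    if x: "x \<in> carrier_vec (Suc k)" "x \<noteq> 0\<^sub>v (Suc k)" and 0: "A *\<^sub>v x = 0\<^sub>v k" for x
  proof -
    let ?y = "x - (f 0 \<bullet> x) \<cdot>\<^sub>v v 0"
    have v0k: "v 0 \<in> carrier_vec (Suc k)" using D(1) by simp
    have "f i \<bullet> ?y = 0" if i: "i < Suc k" for i
    proof -
      have "f i \<bullet> ?y = f i \<bullet> x - (f 0 \<bullet> x) * (f i \<bullet> v 0)"
        using x v0k D(2)[OF i] by (simp add: scalar_prod_minus_distrib)
      moreover have "f i \<bullet> x = 0" if "i \<noteq> 0"
        using Ax[of "i - 1" x] 0 that i by simp
      ultimately show ?thesis using D(3)[OF i, of 0] by auto
    qed
    then have y: "?y = 0\<^sub>v (Suc k)" using dual_system_complete[OF dual] x v0k by auto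
    have "x = (f 0 \<bullet> x) \<cdot>\<^sub>v v 0"
    proof (rule eq_vecI)
      fix i assume "i < dim_vec ((f 0 \<bullet> x) \<cdot>\<^sub>v v 0)"
      then show "x $ i = ((f 0 \<bullet> x) \<cdot>\<^sub>v v 0) $ i"
        using arg_cong[OF y, of "\<lambda>z. z $ i"] v0k x by simp
    qed (use x v0k in auto)
    then have "vec_line x \<subseteq> vec_line (v 0)"
      unfolding vec_line_def by (metis image_subsetI rangeI smult_smult_assoc)
    then show ?thesis using vec_line_subset_imp_eq[OF v0k x(2)] v0 by simp
  qed
  \<comment> \<open>The transpose is injective because \<open>A\<close> sends
    \<open>v (Suc j)\<close> to the unit vector at \<open>j\<close>.\<close>
  have nonzero: "transpose_mat A *\<^sub>v c \<noteq> 0\<^sub>v (Suc k)" if c: "c \<in> carrier_vec k" "c \<noteq> 0\<^sub>v k" for c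
  proof -
    obtain j where j: "j < k" "c $ j \<noteq> 0" using c by (metis carrier_vecD eq_vecI index_zero_vec)
    have vk: "v (Suc j) \<in> carrier_vec (Suc k)" using D(1) j by simp
    have "A *\<^sub>v v (Suc j) = unit_vec k j"
    proof (rule eq_vecI)
      fix i assume "i < dim_vec (unit_vec k j :: 'a vec)"
      then show "(A *\<^sub>v v (Suc j)) $ i = unit_vec k j $ i" using Ax[of i] D(3)[of "Suc i" "Suc j"] j by simp
    qed (use A in auto)
    then have "(transpose_mat A *\<^sub>v c) \<bullet> v (Suc j) = c $ j"
      using transpose_vec_mult_scalar[OF A vk c(1)] c j by simp
    then show ?thesis using j vk by auto
  qed
  \<comment> \<open>An image multiset, because distinct points collinear with \<open>P\<close>
    project to the same point.\<close>
  define G' where "G' = image_mset ((`) ((*\<^sub>v) A)) {#Q \<in># G. Q \<noteq> P#}"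
  have sizeG': "size G' = n - count G P"
    using size_filter_partition[of G "\<lambda>Q. Q = P"] sizeG unfolding G'_def
    by (simp add: filter_eq_replicate_mset)
  have sub_iff: "(*\<^sub>v) A ` Q \<subseteq> vec_hyperplane k c \<longleftrightarrow> Q \<subseteq> vec_hyperplane (Suc k) (transpose_mat A *\<^sub>v c)"
    if Q: "Q \<in># G" and c: "c \<in> carrier_vec k" for Q c
  proof -
    obtain x where x: "x \<in> carrier_vec (Suc k)" "Q = vec_line x" using PG_points_eq_vec_line Q pts by blast
    have "A *\<^sub>v x \<in> carrier_vec k" "transpose_mat A *\<^sub>v c \<in> carrier_vec (Suc k)"
      using A x(1) c by auto
    then show ?thesis
      using x line_image[OF x(1)] c transpose_vec_mult_scalar[OF A x(1) c]
      by (simp add: vec_line_subset_vec_hyperplane_iff)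
  qed
  have P_sub: "P \<subseteq> vec_hyperplane (Suc k) (transpose_mat A *\<^sub>v c)" if c: "c \<in> carrier_vec k" for c
  proof -
    have v0k: "v 0 \<in> carrier_vec (Suc k)" using D(1) by simp
    have "A *\<^sub>v v 0 = 0\<^sub>v k"
      by (rule eq_vecI) (use Ax D(3)[of "Suc _" 0] A in auto)
    then have "(transpose_mat A *\<^sub>v c) \<bullet> v 0 = 0" using transpose_vec_mult_scalar[OF A v0k c] c by simp
    moreover have "transpose_mat A *\<^sub>v c \<in> carrier_vec (Suc k)" using A c by auto
    ultimately show ?thesis using v0 v0k vec_line_subset_vec_hyperplane_iff by blast
  qed
  have size_G'_on: "size (points_on G' (vec_hyperplane k c)) + count G P
      = size (points_on G (vec_hyperplane (Suc k) (transpose_mat A *\<^sub>v c)))"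
    if c: "c \<in> carrier_vec k" for c
  proof -
    let ?H = "vec_hyperplane (Suc k) (transpose_mat A *\<^sub>v c)"
    have "{#Q \<in># {#Q \<in># G. Q \<noteq> P#}. (*\<^sub>v) A ` Q \<subseteq> vec_hyperplane k c#} = {#Q \<in># points_on G ?H. Q \<noteq> P#}"
      unfolding points_on_def filter_filter_mset
      by (rule filter_mset_cong) (use sub_iff c in auto)
    then have "size (points_on G' (vec_hyperplane k c)) = size {#Q \<in># points_on G ?H. Q \<noteq> P#}"
      unfolding G'_def by (simp add: points_on_def filter_mset_image_mset)
    moreover have "{#Q \<in># points_on G ?H. Q = P#} = replicate_mset (count G P) P"
      using P_sub[OF c] by (simp add: filter_eq_replicate_mset points_on_def)
    moreover have "size (points_on G ?H)
        = size {#Q \<in># points_on G ?H. Q = P#} + size {#Q \<in># points_on G ?H. Q \<noteq> P#}"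
      by (rule size_filter_partition)
    ultimately show ?thesis by simp
  qed
  have hyp: "size (points_on G' H) + count G P + d \<le> n \<and> (\<exists>Q\<in>#G'. \<not> Q \<subseteq> H)" if H: "H \<in> PG_hyperplanes k" for H
  proof -
    obtain c where c: "c \<in> carrier_vec k" "c \<noteq> 0\<^sub>v k" "H \<subseteq> vec_hyperplane k c"
      using PG_hyperplane_subset_vec_hyperplane[OF H k] by blast
    let ?c = "transpose_mat A *\<^sub>v c"
    have H': "vec_hyperplane (Suc k) ?c \<in> PG_hyperplanes (Suc k)"
      using A c nonzero[OF c(1,2)] by (intro vec_hyperplane_in_PG_hyperplanes) auto
    obtain Q where Q: "Q \<in># G" "\<not> Q \<subseteq> vec_hyperplane (Suc k) ?c"
      using G H' unfolding linear_code_def by blast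
    then have "(*\<^sub>v) A ` Q \<in># G'" "\<not> (*\<^sub>v) A ` Q \<subseteq> H"
      using P_sub[OF c(1)] sub_iff[OF Q(1) c(1)] c(3) unfolding G'_def by auto
    moreover have "size (points_on G' H) + count G P + d \<le> n"
      using size_points_on_subset[OF c(3), of G'] size_G'_on[OF c(1)]
        linear_code_hyperplane_bound[OF G H'] by linarith
    ultimately show ?thesis by blast
  qed
  have G'_pts: "set_mset G' \<subseteq> PG_points k"
  proof
    fix R assume "R \<in># G'"
    then obtain Q where Q: "Q \<in># G" "Q \<noteq> P" "R = (*\<^sub>v) A ` Q" unfolding G'_def by auto
    obtain x where x: "x \<in> carrier_vec (Suc k)" "x \<noteq> 0\<^sub>v (Suc k)" "Q = vec_line x"
      using PG_points_eq_vec_line Q pts by blast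
    have "A *\<^sub>v x \<noteq> 0\<^sub>v k" using A_eq_0[OF x(1,2)] x(3) Q(2) by blast
    then show "R \<in> PG_points k" using Q(3) x line_image A by (auto intro!: vec_line_in_PG_points)
  qed
  let ?S = "(\<lambda>H. size (points_on G' H)) ` (PG_hyperplanes k :: 'a vec set set)"
  have "Max ?S \<in> ?S" using PG_hyperplanes_nonempty[OF k] finite_PG_hyperplanes by (intro Max_in) auto
  then obtain H0 :: "'a vec set" where H0: "H0 \<in> PG_hyperplanes k" "size (points_on G' H0) = Max ?S" by auto
  \<comment> \<open>The distance is read off from a hyperplane attaining the maximum;
    \<open>hyp\<close> makes the natural subtraction exact.\<close>
  define d' where "d' = n - count G P - Max ?S"
  have "linear_code (size G') k d' G'"
  proof (rule linear_codeI[OF G'_pts _ _ H0(1)])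
    fix H :: "'a vec set" assume H: "H \<in> PG_hyperplanes k"
    show "\<exists>Q\<in>#G'. \<not> Q \<subseteq> H" using hyp[OF H] by blast
    have "size (points_on G' H) \<le> Max ?S" using H finite_PG_hyperplanes by (intro Max_ge) auto
    then show "size (points_on G' H) + d' \<le> size G'"
      using hyp[OF H0(1)] unfolding sizeG' d'_def H0(2) by linarith
  next
    show "size (points_on G' H0) + d' = size G'"
      using hyp[OF H0(1)] unfolding sizeG' d'_def H0(2) by linarith
  qed
  moreover have "d \<le> d'" using hyp[OF H0(1)] unfolding d'_def H0(2) by linarith
  ultimately show thesis using that sizeG' by metis
qed

section \<open>Lengthening a code, and bounds on its length\<close>

text \<open>Repeating a point of a hyperplane with maximal intersection raises both the length and
  that maximum by 1, so \<open>d\<close> stays fixed and the defect grows by 1.\<close>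

lemma linear_code_extend:
  fixes G :: "'a::{field,finite} vec set multiset"
  assumes G: "linear_code n k d G" and k: "k \<ge> 2"
  shows "\<exists>G' :: 'a vec set multiset. linear_code (n + t) k d G'"
proof (induction t)
  case 0
  then show ?case using G by auto
next
  case (Suc t)
  then obtain G' :: "'a vec set multiset" where G': "linear_code (n + t) k d G'" by blast
  obtain H where H: "H \<in> PG_hyperplanes k" "size (points_on G' H) + d = n + t"
    using linear_code_max_hyperplane[OF G'] k by auto
  \<comment> \<open>By the Singleton bound a maximal hyperplane has at least \<open>k - 1\<close>
    code points, hence at least one.\<close>
  have "points_on G' H \<noteq> {#}" using singleton_bound[OF G'] H(2) k by auto
  then obtain P where "P \<in># points_on G' H" by blast
  then have P: "P \<in># G'" "P \<subseteq> H" by (auto simp: points_on_def)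
  have "linear_code (size (add_mset P G')) k d (add_mset P G')"
  proof (rule linear_codeI[OF _ _ _ H(1)])
    show "set_mset (add_mset P G') \<subseteq> PG_points k" using G' P by (auto simp: linear_code_def)
    show "size (points_on (add_mset P G') H) + d = size (add_mset P G')"
      using H(2) P G' by (simp add: size_points_on_add_mset linear_code_def)
  next
    fix K :: "'a vec set" assume K: "K \<in> PG_hyperplanes k"
    show "\<exists>Q\<in>#add_mset P G'. \<not> Q \<subseteq> K" using K G' unfolding linear_code_def by auto
    show "size (points_on (add_mset P G') K) + d \<le> size (add_mset P G')"
      using linear_code_hyperplane_bound[OF G' K] G'
      by (simp add: size_points_on_add_mset linear_code_def)
  qed
  moreover have "size (add_mset P G') = n + Suc t" using G' by (simp add: linear_code_def)
  ultimately show ?case by metis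
qed

text \<open>This makes the \<open>Max\<close> in \<open>max_AsMDS_length\<close> meaningful. For
  \<open>k\<close> at least 2 every point lies on a hyperplane, which bounds its multiplicity, and
  there are finitely many points.\<close>

lemma finite_AsMDS_lengths:
  assumes k: "k \<ge> 2"
  shows "finite {n. \<exists>d (G :: 'a::{field,finite} vec set multiset). AsMDS_code s n k d G}"
proof (rule finite_subset)
  let ?N = "card (PG_points k :: 'a vec set set) * (k + s)"
  show "{n. \<exists>d (G :: 'a vec set multiset). AsMDS_code s n k d G} \<subseteq> {..?N}"
  proof clarify
    fix n d and G :: "'a vec set multiset" assume G: "AsMDS_code s n k d G"
    have pts: "set_mset G \<subseteq> PG_points k" and n: "n = size G"
      using G by (auto simp: AsMDS_code_def linear_code_def)
    have "count G P \<le> k + s" if P: "P \<in># G" for P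
    proof -
      obtain x where x: "x \<in> carrier_vec k" "P = vec_line x" using PG_points_eq_vec_line P pts by blast
      obtain c where c: "c \<in> carrier_vec k" "c \<noteq> 0\<^sub>v k" "c \<bullet> x = 0"
        using exists_common_annihilator[of 1 k "\<lambda>_. x"] k x by auto
      have "P \<subseteq> vec_hyperplane k c" using x c by (simp add: vec_line_subset_vec_hyperplane_iff)
      then have "count G P = count (points_on G (vec_hyperplane k c)) P" by (simp add: points_on_def)
      also have "\<dots> \<le> size (points_on G (vec_hyperplane k c))" by (rule count_le_size)
      finally show ?thesis using AsMDS_code_hyperplane_bound[OF G c(1,2)] by simp
    qed
    then have "size G \<le> card (set_mset G) * (k + s)"
      unfolding size_multiset_overloaded_eq using sum_bounded_above[of "set_mset G" "count G" "k + s"] by simp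
    also have "\<dots> \<le> ?N"
      using pts finite_lin_subspaces unfolding PG_points_def by (intro mult_right_mono card_mono) auto
    finally show "n \<le> ?N" using n by simp
  qed
qed simp

lemma AsMDS_code_not_projective_length_le_max:
  fixes G :: "'a::{field,finite} vec set multiset"
  assumes G: "AsMDS_code s n k d G" and k: "k \<ge> 3" and "\<not> projective_code G"
  shows "n \<le> max_AsMDS_length TYPE('a) (s - 1) (k - 1) + 2"
proof -
  obtain P where P: "P \<in># G" "count G P \<ge> 2" using assms(3) by (rule not_projective_codeE)
  have code: "linear_code n k d G" and defect: "int n - int k + 1 - int d = int s"
    using G by (simp_all add: AsMDS_code_def singleton_defect_def)
  have mn: "count G P \<le> n" using count_le_size[of G P] code by (simp add: linear_code_def)
  have "linear_code n (Suc (k - 1)) d G" "k - 1 \<ge> 1" using code k by auto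
  then obtain d' and G' :: "'a vec set multiset" where
    G': "linear_code (n - count G P) (k - 1) d' G'" and dd': "d \<le> d'"
    using linear_code_projection P(1) by blast
  have sb: "k - 1 + d' \<le> n - count G P + 1" using singleton_bound[OF G'] k by simp
  \<comment> \<open>The number of lengthenings that bring the projected code to defect exactly
    \<open>s - 1\<close>. The Singleton bound for that code and the multiplicity of at least 2 force
    \<open>s\<close> to be positive, so the subtractions are exact.\<close>
  define t where "t = s - 1 - (n - count G P + 1 - (k - 1 + d'))"
  have t: "int t = int s - 1 - (int n - int (count G P) + 1 - (int k - 1 + int d'))"
    unfolding t_def using sb dd' defect mn P(2) k by linarith
  obtain G'' :: "'a vec set multiset" where G'': "linear_code (n - count G P + t) (k - 1) d' G''"
    using linear_code_extend[OF G', of t] k by fastforce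
  have "AsMDS_code (s - 1) (n - count G P + t) (k - 1) d' G''"
    unfolding AsMDS_code_def singleton_defect_def using G'' t sb dd' defect mn P(2) k by linarith
  then have "n - count G P + t \<le> max_AsMDS_length TYPE('a) (s - 1) (k - 1)"
    unfolding max_AsMDS_length_def using k by (intro Max_ge finite_AsMDS_lengths) auto
  \<comment> \<open>The new length equals \<open>n - 2 + (d' - d)\<close>, whatever the multiplicity
    of \<open>P\<close>.\<close>
  then show ?thesis using t dd' defect mn by linarith
qed

theorem mainTheorem3:
  fixes G :: "'a::{field,finite} vec set multiset" and n k d s q :: nat
  assumes "q = CARD('a)"
    and "k \<ge> 2"
    and "AsMDS_code s n k d G"
  shows "(s = 0 \<longrightarrow> projective_code G) \<and>
         (k = 2 \<longrightarrow> (projective_code G \<longleftrightarrow> s = 0)) \<and>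
         (s > 0 \<and> k > 2 \<and> n > max_AsMDS_length TYPE('a) (s - 1) (k - 1) + 2 \<longrightarrow> projective_code G) \<and>
         (k > 2 \<and> n > s * (q + 1) + k - 1 \<longrightarrow> projective_code G) \<and>
         (s = 1 \<and> k > q \<and> n > k + 2 \<longrightarrow> projective_code G)"
proof (intro conjI impI)
  show MDS: "projective_code G" if "s = 0"
    using MDS_code_projective assms(2,3) that by blast
  show "projective_code G \<longleftrightarrow> s = 0" if "k = 2"
    using MDS projective_AsMDS_code_dim_2 assms(3) that by blast
  \<comment> \<open>The last three claims are contrapositives: a repeated point bounds
    \<open>n\<close> from above, or bounds \<open>k\<close> by \<open>q\<close>.\<close>
  show "projective_code G" if "s > 0 \<and> k > 2 \<and> n > max_AsMDS_length TYPE('a) (s - 1) (k - 1) + 2"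
    using AsMDS_code_not_projective_length_le_max[OF assms(3)] that by linarith
  show "projective_code G" if "k > 2 \<and> n > s * (q + 1) + k - 1"
    using AsMDS_code_not_projective_length_le[OF assms(3)] assms(1) that by fastforce
  show "projective_code G" if "s = 1 \<and> k > q \<and> n > k + 2"
    using almost_MDS_code_not_projective_dim_le[of n k d G] assms that by fastforce
qed

end
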